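(* Let $(X,d)$ be a nonempty pseudometric space with metric reflection $(X/{\sim_d},\delta_d)$. Then the following statements are equivalent: (i) At least one of the following conditions is fulfilled: (i$_1$) $(X,d)$ is strongly rigid; (i$_2$) $(X,d)$ is discrete; (i$_3$) $(X,d)$ is a pseudorectangle. (ii) The equality $\mathbf{Cs}(X/{\sim_d},\delta_d)=\mathbf{Sym}(X/{\sim_d})$ holds.
   Context: A pseudometric on a set $X$ is a function $d\colon X^2\to\mathbb{R}$ that is non-negative, symmetric, satisfies $d(x,x)=0$ for all $x$, and satisfies the triangle inequality. Write $d(X^2)=\{d(x,y):x,y\in X\}$. The relation $x\sim_d y :\Leftrightarrow d(x,y)=0$ is an equivalence relation on $X$; the metric reflection of $(X,d)$ is the metric space $(X/{\sim_d},\delta_d)$ with $\delta_d(\alpha,\beta)=d(x,y)$ for $x\in\alpha$, $y\in\beta$ (well defined). A combinatorial self-similarity of a (pseudo)metric space $(X,d)$ is a bijection $\Psi\colon X\to X$ for which there is a bijection $f\colon d(X^2)\to d(X^2)$ with $d(x,y)=f(d(\Psi(x),\Psi(y)))$ for all $x,y\in X$; $\mathbf{Cs}(X,d)$ is the group of all of them. $\mathbf{Sym}(X)$ is the group of all permutations of $X$. A metric subspace of a pseudometric space $(X,d)$ is a subset $Y\subseteq X$ such that $d|_{Y^2}$ is a metric. A metric space is strongly rigid if $d(x,y)=d(u,v)\neq 0$ implies $\{x,y\}=\{u,v\}$; a metric space is discrete if $|d(X^2)|\le 2$. A pseudometric space is strongly rigid (resp. discrete) if all its metric subspaces are strongly rigid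 (resp. discrete). A pseudometric space $(X,d)$ is a pseudorectangle if all three-point metric subspaces of $(X,d)$ are strongly rigid and pairwise isometric and, in addition, there is a four-point metric subspace $Y$ of $(X,d)$ such that for every $x\in X$ there is $y\in Y$ with $d(x,y)=0$. *)

theory Defs
  imports Complex_Main "HOL-Algebra.Bij"
begin

text \<open>All axioms are relativised to the carrier; the library locale \<open>Metric_space\<close>
  instead demands non-negativity and symmetry on the whole type, which is why it is not used.\<close>

locale pseudometric_space =
  fixes X :: "'a set" and d :: "'a \<Rightarrow> 'a \<Rightarrow> real"
  assumes nonneg: "\<lbrakk>x \<in> X; y \<in> X\<rbrakk> \<Longrightarrow> 0 \<le> d x y"
    and commute: "\<lbrakk>x \<in> X; y \<in> X\<rbrakk> \<Longrightarrow> d x y = d y x"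
    and zero_refl: "x \<in> X \<Longrightarrow> d x x = 0"
    and triangle: "\<lbrakk>x \<in> X; y \<in> X; z \<in> X\<rbrakk> \<Longrightarrow> d x z \<le> d x y + d y z"

locale metric_space_on = pseudometric_space +
  assumes zero_imp_eq: "\<lbrakk>x \<in> X; y \<in> X; d x y = 0\<rbrakk> \<Longrightarrow> x = y"

definition dist_values :: "'a set \<Rightarrow> ('a \<Rightarrow> 'a \<Rightarrow> real) \<Rightarrow> real set"
  where "dist_values X d = {d x y |x y. x \<in> X \<and> y \<in> X}"

definition zero_rel :: "'a set \<Rightarrow> ('a \<Rightarrow> 'a \<Rightarrow> real) \<Rightarrow> 'a rel"
  where "zero_rel X d = {(x, y). x \<in> X \<and> y \<in> X \<and> d x y = 0}"

definition reflection :: "'a set \<Rightarrow> ('a \<Rightarrow> 'a \<Rightarrow> real) \<Rightarrow> 'a set set"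
  where "reflection X d = X // zero_rel X d"

definition reflection_dist :: "('a \<Rightarrow> 'a \<Rightarrow> real) \<Rightarrow> 'a set \<Rightarrow> 'a set \<Rightarrow> real"
  where "reflection_dist d \<alpha> \<beta> = (THE r. \<exists>x\<in>\<alpha>. \<exists>y\<in>\<beta>. r = d x y)"

definition comb_self_similarity :: "'a set \<Rightarrow> ('a \<Rightarrow> 'a \<Rightarrow> real) \<Rightarrow> ('a \<Rightarrow> 'a) \<Rightarrow> bool"
  where "comb_self_similarity X d \<Psi> \<longleftrightarrow>
    bij_betw \<Psi> X X \<and>
    (\<exists>f. bij_betw f (dist_values X d) (dist_values X d) \<and>
         (\<forall>x\<in>X. \<forall>y\<in>X. d x y = f (d (\<Psi> x) (\<Psi> y))))"

text \<open>The symmetric group on a set \<open>X\<close> is the library's \<open>BijGroup X\<close>, whose elements are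
  the bijections of \<open>X\<close> that are extensional (\<open>undefined\<close> outside \<open>X\<close>), so that
  equality of elements is equality on \<open>X\<close>.\<close>

definition Cs :: "'a set \<Rightarrow> ('a \<Rightarrow> 'a \<Rightarrow> real) \<Rightarrow> ('a \<Rightarrow> 'a) monoid"
  where "Cs X d = (BijGroup X)\<lparr>carrier := {\<Psi> \<in> Bij X. comb_self_similarity X d \<Psi>}\<rparr>"

definition metric_subspace :: "'a set \<Rightarrow> 'a set \<Rightarrow> ('a \<Rightarrow> 'a \<Rightarrow> real) \<Rightarrow> bool"
  where "metric_subspace Y X d \<longleftrightarrow> Y \<subseteq> X \<and> metric_space_on Y d"

definition strongly_rigid_metric :: "'a set \<Rightarrow> ('a \<Rightarrow> 'a \<Rightarrow> real) \<Rightarrow> bool"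
  where "strongly_rigid_metric Y d \<longleftrightarrow>
    (\<forall>x\<in>Y. \<forall>y\<in>Y. \<forall>u\<in>Y. \<forall>v\<in>Y. d x y = d u v \<and> d u v \<noteq> 0 \<longrightarrow> {x, y} = {u, v})"

definition discrete_metric :: "'a set \<Rightarrow> ('a \<Rightarrow> 'a \<Rightarrow> real) \<Rightarrow> bool"
  where "discrete_metric Y d \<longleftrightarrow> finite (dist_values Y d) \<and> card (dist_values Y d) \<le> 2"

definition isometric :: "'a set \<Rightarrow> 'a set \<Rightarrow> ('a \<Rightarrow> 'a \<Rightarrow> real) \<Rightarrow> bool"
  where "isometric Y Z d \<longleftrightarrow>
    (\<exists>g. bij_betw g Y Z \<and> (\<forall>x\<in>Y. \<forall>y\<in>Y. d (g x) (g y) = d x y))"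

definition strongly_rigid :: "'a set \<Rightarrow> ('a \<Rightarrow> 'a \<Rightarrow> real) \<Rightarrow> bool"
  where "strongly_rigid X d \<longleftrightarrow> (\<forall>Y. metric_subspace Y X d \<longrightarrow> strongly_rigid_metric Y d)"

definition discrete_pseudometric :: "'a set \<Rightarrow> ('a \<Rightarrow> 'a \<Rightarrow> real) \<Rightarrow> bool"
  where "discrete_pseudometric X d \<longleftrightarrow> (\<forall>Y. metric_subspace Y X d \<longrightarrow> discrete_metric Y d)"

definition pseudorectangle :: "'a set \<Rightarrow> ('a \<Rightarrow> 'a \<Rightarrow> real) \<Rightarrow> bool"
  where "pseudorectangle X d \<longleftrightarrow>
    (\<forall>Y. metric_subspace Y X d \<and> card Y = 3 \<longrightarrow> strongly_rigid_metric Y d) \<and>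
    (\<forall>Y Z. metric_subspace Y X d \<and> card Y = 3 \<and> metric_subspace Z X d \<and> card Z = 3
        \<longrightarrow> isometric Y Z d) \<and>
    (\<exists>Y. metric_subspace Y X d \<and> card Y = 4 \<and> (\<forall>x\<in>X. \<exists>y\<in>Y. d x y = 0))"

context pseudometric_space
begin

lemma equiv_zero_rel: "equiv X (zero_rel X d)"
proof (rule equivI)
  show "zero_rel X d \<subseteq> X \<times> X" by (auto simp: zero_rel_def)
  show "refl_on X (zero_rel X d)" by (auto simp: refl_on_def zero_rel_def zero_refl)
  show "sym (zero_rel X d)" by (auto simp: sym_def zero_rel_def commute)
  show "trans (zero_rel X d)"
  proof (rule transI)
    fix x y z assume "(x, y) \<in> zero_rel X d" "(y, z) \<in> zero_rel X d"
    then show "(x, z) \<in> zero_rel X d"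
      using triangle[of x y z] nonneg[of x z] by (auto simp: zero_rel_def)
  qed
qed

lemma dist_cong:
  assumes "(x, x') \<in> zero_rel X d" "(y, y') \<in> zero_rel X d"
  shows "d x y = d x' y'"
proof -
  have X: "x \<in> X" "x' \<in> X" "y \<in> X" "y' \<in> X" and z: "d x x' = 0" "d y y' = 0"
    using assms by (auto simp: zero_rel_def)
  have z': "d x' x = 0" "d y' y = 0" using z X commute by auto
  show ?thesis
    using triangle[of x x' y] triangle[of x' y' y] triangle[of x' x y'] triangle[of x y y'] X z z'
    by linarith
qed

lemma reflection_dist_eq:
  assumes "\<alpha> \<in> reflection X d" "\<beta> \<in> reflection X d" "x \<in> \<alpha>" "y \<in> \<beta>"
  shows "reflection_dist d \<alpha> \<beta> = d x y"
  unfolding reflection_dist_def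
proof (rule the_equality)
  show "\<exists>u\<in>\<alpha>. \<exists>v\<in>\<beta>. d x y = d u v" using assms by blast
  fix r assume "\<exists>u\<in>\<alpha>. \<exists>v\<in>\<beta>. r = d u v"
  then obtain u v where uv: "u \<in> \<alpha>" "v \<in> \<beta>" "r = d u v" by blast
  have "(u, x) \<in> zero_rel X d" "(v, y) \<in> zero_rel X d"
    using assms uv quotient_eq_iff[OF equiv_zero_rel] unfolding reflection_def by blast+
  then show "r = d x y" using dist_cong uv by simp
qed

lemma metric_space_reflection: "metric_space_on (reflection X d) (reflection_dist d)"
proof -
  have rep: "\<exists>x. x \<in> \<alpha> \<and> x \<in> X" if "\<alpha> \<in> reflection X d" for \<alpha>
    using that in_quotient_imp_non_empty[OF equiv_zero_rel] in_quotient_imp_subset[OF equiv_zero_rel]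
    unfolding reflection_def by blast
  show ?thesis
  proof
    fix \<alpha> \<beta> assume a: "\<alpha> \<in> reflection X d" and b: "\<beta> \<in> reflection X d"
    obtain x y where x: "x \<in> \<alpha>" "x \<in> X" and y: "y \<in> \<beta>" "y \<in> X" using rep a b by meson
    have e: "reflection_dist d \<alpha> \<beta> = d x y" "reflection_dist d \<beta> \<alpha> = d y x"
      using reflection_dist_eq a b x y by blast+
    show "0 \<le> reflection_dist d \<alpha> \<beta>" using e nonneg x y by simp
    show "reflection_dist d \<alpha> \<beta> = reflection_dist d \<beta> \<alpha>" using e commute x y by simp
    show "reflection_dist d \<alpha> \<alpha> = 0" using reflection_dist_eq[OF a a x(1) x(1)] zero_refl x by simp
    show "\<alpha> = \<beta>" if "reflection_dist d \<alpha> \<beta> = 0"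
      using that e x y a b quotient_eq_iff[OF equiv_zero_rel, of \<alpha> \<beta> x y]
      by (simp add: reflection_def zero_rel_def)
    fix \<gamma> assume c: "\<gamma> \<in> reflection X d"
    obtain z where z: "z \<in> \<gamma>" "z \<in> X" using rep c by meson
    show "reflection_dist d \<alpha> \<gamma> \<le> reflection_dist d \<alpha> \<beta> + reflection_dist d \<beta> \<gamma>"
      using triangle[OF x(2) y(2) z(2)] reflection_dist_eq[OF a b x(1) y(1)]
        reflection_dist_eq[OF b c y(1) z(1)] reflection_dist_eq[OF a c x(1) z(1)] by linarith
  qed
qed

end

lemma subgroup_Cs: "subgroup (carrier (Cs X d)) (BijGroup X)"
proof -
  interpret group "BijGroup X" by (rule group_BijGroup)
  show ?thesis
  proof (rule subgroupI)
    show "carrier (Cs X d) \<subseteq> carrier (BijGroup X)" by (auto simp: Cs_def BijGroup_def)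
    have "comb_self_similarity X d (\<lambda>x\<in>X. x)"
      unfolding comb_self_similarity_def
      by (rule conjI, use id_Bij[of X] in \<open>simp add: Bij_def\<close>, rule exI[of _ id]) auto
    then show "carrier (Cs X d) \<noteq> {}" using id_Bij[of X] by (auto simp: Cs_def)
  next
    fix \<Psi> assume "\<Psi> \<in> carrier (Cs X d)"
    then have B: "\<Psi> \<in> Bij X" and "comb_self_similarity X d \<Psi>" by (auto simp: Cs_def)
    then obtain f where bij: "bij_betw \<Psi> X X" and f: "bij_betw f (dist_values X d) (dist_values X d)"
      and eq: "\<And>x y. x \<in> X \<Longrightarrow> y \<in> X \<Longrightarrow> d x y = f (d (\<Psi> x) (\<Psi> y))"
      unfolding comb_self_similarity_def by blast
    let ?D = "dist_values X d" and ?i = "restrict (inv_into X \<Psi>) X"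
    have iX: "inv_into X \<Psi> x \<in> X" "\<Psi> (inv_into X \<Psi> x) = x" if "x \<in> X" for x
      using that bij by (auto simp: bij_betw_def inv_into_into f_inv_into_f)
    have "d x y = inv_into ?D f (d (?i x) (?i y))" if "x \<in> X" "y \<in> X" for x y
    proof -
      have "d x y \<in> ?D" using that by (auto simp: dist_values_def)
      then show ?thesis using that eq[of "?i x" "?i y"] iX f by (simp add: bij_betw_def)
    qed
    then have "comb_self_similarity X d ?i"
      unfolding comb_self_similarity_def
      using bij_betw_inv_into[OF f] restrict_inv_into_Bij[OF B] unfolding Bij_def by blast
    then show "inv\<^bsub>BijGroup X\<^esub> \<Psi> \<in> carrier (Cs X d)"
      using B restrict_inv_into_Bij[OF B] by (simp add: inv_BijGroup Cs_def)
  next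
    fix \<Phi> \<Psi> assume "\<Phi> \<in> carrier (Cs X d)" "\<Psi> \<in> carrier (Cs X d)"
    then have B: "\<Phi> \<in> Bij X" "\<Psi> \<in> Bij X"
      and "comb_self_similarity X d \<Phi>" "comb_self_similarity X d \<Psi>" by (auto simp: Cs_def)
    then obtain f g where fg: "bij_betw f (dist_values X d) (dist_values X d)"
        "bij_betw g (dist_values X d) (dist_values X d)"
      and eq: "\<And>x y. x \<in> X \<Longrightarrow> y \<in> X \<Longrightarrow> d x y = f (d (\<Phi> x) (\<Phi> y))"
        "\<And>x y. x \<in> X \<Longrightarrow> y \<in> X \<Longrightarrow> d x y = g (d (\<Psi> x) (\<Psi> y))"
      unfolding comb_self_similarity_def by blast
    have "d x y = (g \<circ> f) (d (compose X \<Phi> \<Psi> x) (compose X \<Phi> \<Psi> y))" if "x \<in> X" "y \<in> X" for x y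
      using that eq(2)[of x y] eq(1)[of "\<Psi> x" "\<Psi> y"] Bij_imp_funcset[OF B(2)]
      by (auto simp: compose_def Pi_iff)
    then have "comb_self_similarity X d (compose X \<Phi> \<Psi>)"
      unfolding comb_self_similarity_def
      using bij_betw_trans[OF fg] compose_Bij[OF B] unfolding Bij_def by blast
    then show "\<Phi> \<otimes>\<^bsub>BijGroup X\<^esub> \<Psi> \<in> carrier (Cs X d)"
      using B compose_Bij[OF B] by (simp add: Cs_def BijGroup_def)
  qed
qed

end

theory Submission
  imports Defs "HOL-Combinatorics.Transposition"
begin

text \<open>A permutation is a combinatorial self-similarity iff it preserves the relation
  \<open>d x y = d u v\<close>. For two distinct edges this relation concerns either adjacent edges
  \<open>{a, b}, {a, c}\<close> or opposite edges \<open>{a, b}, {c, e}\<close>, and the symmetric group acts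
  transitively on the configurations of either kind. So all permutations of a metric space are
  combinatorial self-similarities iff adjacent edges are always equal or never equal, and
  likewise opposite edges. Adjacent edges are always equal iff the space is discrete. If they never
  are, then the space is strongly rigid when opposite edges are never equal; when opposite edges
  are always equal, there are at most four points, since a fifth point \<open>w\<close> would give
  \<open>d c e = d a b = d c w\<close>, and any two triangles have the same three sides.
  A pseudometric space and its metric reflection satisfy the same conditions of this kind,
  because the vertices of a configuration are required to have nonzero distances.\<close>

lemma ex_bij_betw_images_iff:
  "(\<exists>f. bij_betw f (g ` S) (h ` S) \<and> (\<forall>p\<in>S. h p = f (g p))) \<longleftrightarrow>
    (\<forall>p\<in>S. \<forall>q\<in>S. g p = g q \<longleftrightarrow> h p = h q)"
proof
  assume "\<exists>f. bij_betw f (g ` S) (h ` S) \<and> (\<forall>p\<in>S. h p = f (g p))"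
  then obtain f where "inj_on f (g ` S)" and "\<forall>p\<in>S. h p = f (g p)"
    by (auto simp: bij_betw_def)
  then show "\<forall>p\<in>S. \<forall>q\<in>S. g p = g q \<longleftrightarrow> h p = h q"
    by (simp add: inj_on_eq_iff)
next
  assume same_fibres: "\<forall>p\<in>S. \<forall>q\<in>S. g p = g q \<longleftrightarrow> h p = h q"
  define f where "f = h \<circ> inv_into S g"
  have f: "h p = f (g p)" if "p \<in> S" for p
    using same_fibres that inv_into_into[of "g p" g S] f_inv_into_f[of "g p" g S]
    by (simp add: f_def)
  then have "bij_betw f (g ` S) (h ` S)"
    using same_fibres by (auto simp: bij_betw_def inj_on_def image_image)
  with f show "\<exists>f. bij_betw f (g ` S) (h ` S) \<and> (\<forall>p\<in>S. h p = f (g p))"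
    by blast
qed

lemma ex_bij_betw_map_eq:
  assumes "length xs = length ys" "distinct xs" "distinct ys" "set xs \<subseteq> X" "set ys \<subseteq> X"
  shows "\<exists>f. bij_betw f X X \<and> map f xs = ys"
  using assms
proof (induction xs ys rule: list_induct2)
  case Nil
  show ?case by (intro exI[of _ id] conjI bij_betw_id) simp
next
  case (Cons x xs y ys)
  then obtain f where f: "bij_betw f X X" and ys: "map f xs = ys" by auto
  define g where "g = transpose (f x) y \<circ> f"
  have "f x \<in> X" using f Cons.prems by (auto simp: bij_betw_def)
  then have "bij_betw g X X"
    using f Cons.prems unfolding g_def by (auto intro: bij_betw_trans)
  moreover have "f x \<notin> set ys"
    using inj_on_image_mem_iff[OF bij_betw_imp_inj_on[OF f], of x "set xs"] Cons.prems ys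
    by auto
  then have "map (transpose (f x) y) ys = ys"
    using Cons.prems by (intro map_idI transpose_apply_other) auto
  then have "map g (x # xs) = y # ys"
    by (simp add: g_def flip: ys)
  ultimately show ?case by (intro exI[of _ g]) simp
qed

lemma card_4_iff: "card S = 4 \<longleftrightarrow> (\<exists>a b c e. S = {a, b, c, e} \<and> distinct [a, b, c, e])"
proof
  assume "card S = 4"
  then obtain a T where "S = insert a T" "a \<notin> T" "card T = 3"
    using card_eq_SucD[of S 3] by auto
  then show "\<exists>a b c e. S = {a, b, c, e} \<and> distinct [a, b, c, e]"
    by (fastforce simp: card_3_iff)
qed auto

lemma edge_pair_cases:
  assumes "x \<noteq> y" "u \<noteq> v"
  obtains (same) "{x, y} = {u, v}"
  | (adjacent) a b c where "{x, y} = {a, b}" "{u, v} = {a, c}" "distinct [a, b, c]"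
  | (opposite) "distinct [x, y, u, v]"
proof -
  consider "{x, y} = {u, v}" | "distinct [x, y, u, v]"
    | "x = u" "y \<noteq> v" | "x = v" "y \<noteq> u" | "y = u" "x \<noteq> v" | "y = v" "x \<noteq> u"
    using assms by auto
  then show thesis
  proof cases
    case 3 then show thesis using assms by (intro adjacent[of x y v]) auto
  next
    case 4 then show thesis using assms by (intro adjacent[of x y u]) auto
  next
    case 5 then show thesis using assms by (intro adjacent[of y x v]) auto
  next
    case 6 then show thesis using assms by (intro adjacent[of y x u]) auto
  qed (use same opposite in blast)+
qed

section \<open>Permutations preserving equality of distances\<close>

definition preserves_equidistance :: "'a set \<Rightarrow> ('a \<Rightarrow> 'a \<Rightarrow> real) \<Rightarrow> ('a \<Rightarrow> 'a) \<Rightarrow> bool"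
  where "preserves_equidistance X d \<Psi> \<longleftrightarrow>
    (\<forall>x\<in>X. \<forall>y\<in>X. \<forall>u\<in>X. \<forall>v\<in>X. d (\<Psi> x) (\<Psi> y) = d (\<Psi> u) (\<Psi> v) \<longleftrightarrow> d x y = d u v)"

lemma preserves_equidistance_restrict [simp]:
  "preserves_equidistance X d (restrict \<Psi> X) \<longleftrightarrow> preserves_equidistance X d \<Psi>"
  by (simp add: preserves_equidistance_def)

lemma dist_values_conv_image: "dist_values X d = case_prod d ` (X \<times> X)"
  by (auto simp: dist_values_def)

lemma dist_values_image: "dist_values (g ` X) d = (\<lambda>(x, y). d (g x) (g y)) ` (X \<times> X)"
proof -
  have "dist_values (g ` X) d = case_prod d ` map_prod g g ` (X \<times> X)"
    by (simp only: dist_values_conv_image map_prod_surj_on[OF refl refl])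
  then show ?thesis by (simp add: image_image case_prod_beta)
qed

lemma comb_self_similarity_iff:
  assumes "bij_betw \<Psi> X X"
  shows "comb_self_similarity X d \<Psi> \<longleftrightarrow> preserves_equidistance X d \<Psi>"
proof -
  have "dist_values X d = (\<lambda>(x, y). d (\<Psi> x) (\<Psi> y)) ` (X \<times> X)"
    using dist_values_image[of \<Psi> X d] bij_betw_imp_surj_on[OF assms] by simp
  then show ?thesis
    using ex_bij_betw_images_iff[of "\<lambda>(x, y). d (\<Psi> x) (\<Psi> y)" "X \<times> X" "case_prod d"] assms
    unfolding comb_self_similarity_def preserves_equidistance_def
    by (simp add: dist_values_conv_image)
qed

lemma Cs_eq_BijGroup_iff_preserves_equidistance:
  "Cs X d = BijGroup X \<longleftrightarrow> (\<forall>\<Psi>. bij_betw \<Psi> X X \<longrightarrow> preserves_equidistance X d \<Psi>)"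
proof -
  have "Cs X d = BijGroup X \<longleftrightarrow> (\<forall>\<Psi>\<in>Bij X. comb_self_similarity X d \<Psi>)"
    by (auto simp: Cs_def BijGroup_def)
  also have "\<dots> \<longleftrightarrow> (\<forall>\<Psi>\<in>Bij X. preserves_equidistance X d \<Psi>)"
    by (simp add: Bij_def comb_self_similarity_iff)
  also have "\<dots> \<longleftrightarrow> (\<forall>\<Psi>. bij_betw \<Psi> X X \<longrightarrow> preserves_equidistance X d \<Psi>)"
  proof (intro iffI allI impI ballI)
    fix \<Psi> assume all_preserve: "\<forall>\<Psi>\<in>Bij X. preserves_equidistance X d \<Psi>" and "bij_betw \<Psi> X X"
    then have "restrict \<Psi> X \<in> Bij X" by (simp add: Bij_def)
    with all_preserve have "preserves_equidistance X d (restrict \<Psi> X)" by blast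
    then show "preserves_equidistance X d \<Psi>" by simp
  qed (simp add: Bij_def)
  finally show ?thesis .
qed

lemma Cs_eq_BijGroup_imp_nth_dist_eq_iff:
  assumes "Cs X d = BijGroup X"
    and "distinct xs" "distinct ys" "set xs \<subseteq> X" "set ys \<subseteq> X" "length xs = length ys"
    and "i < length xs" "j < length xs" "k < length xs" "l < length xs"
  shows "d (xs ! i) (xs ! j) = d (xs ! k) (xs ! l) \<longleftrightarrow> d (ys ! i) (ys ! j) = d (ys ! k) (ys ! l)"
proof -
  obtain \<Psi> where \<Psi>: "bij_betw \<Psi> X X" and ys: "ys = map \<Psi> xs"
    using ex_bij_betw_map_eq assms by metis
  have "preserves_equidistance X d \<Psi>"
    using assms(1) \<Psi> by (simp add: Cs_eq_BijGroup_iff_preserves_equidistance)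
  moreover have "xs ! i \<in> X" "xs ! j \<in> X" "xs ! k \<in> X" "xs ! l \<in> X"
    using assms by auto
  ultimately show ?thesis
    using assms by (simp add: ys preserves_equidistance_def)
qed

section \<open>Adjacent and opposite edges\<close>

definition separated :: "'a set \<Rightarrow> ('a \<Rightarrow> 'a \<Rightarrow> real) \<Rightarrow> 'a list \<Rightarrow> bool"
  where "separated X d xs \<longleftrightarrow> set xs \<subseteq> X \<and> sorted_wrt (\<lambda>x y. d x y \<noteq> 0) xs"

definition edge_pairs_related ::
    "(real \<Rightarrow> real \<Rightarrow> bool) \<Rightarrow> nat \<Rightarrow> nat \<Rightarrow> nat \<Rightarrow> nat \<Rightarrow> nat \<Rightarrow>
      'a set \<Rightarrow> ('a \<Rightarrow> 'a \<Rightarrow> real) \<Rightarrow> bool"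
  where "edge_pairs_related R n i j k l X d \<longleftrightarrow>
    (\<forall>xs. separated X d xs \<and> length xs = n \<longrightarrow> R (d (xs ! i) (xs ! j)) (d (xs ! k) (xs ! l)))"

definition adjacent_edges :: "(real \<Rightarrow> real \<Rightarrow> bool) \<Rightarrow> 'a set \<Rightarrow> ('a \<Rightarrow> 'a \<Rightarrow> real) \<Rightarrow> bool"
  where "adjacent_edges R = edge_pairs_related R 3 0 1 0 2"

definition opposite_edges :: "(real \<Rightarrow> real \<Rightarrow> bool) \<Rightarrow> 'a set \<Rightarrow> ('a \<Rightarrow> 'a \<Rightarrow> real) \<Rightarrow> bool"
  where "opposite_edges R = edge_pairs_related R 4 0 1 2 3"

definition edge_homogeneous :: "'a set \<Rightarrow> ('a \<Rightarrow> 'a \<Rightarrow> real) \<Rightarrow> bool"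
  where "edge_homogeneous X d \<longleftrightarrow>
    (adjacent_edges (=) X d \<or> adjacent_edges (\<noteq>) X d) \<and>
    (opposite_edges (=) X d \<or> opposite_edges (\<noteq>) X d)"

lemma adjacent_edges_iff:
  "adjacent_edges R X d \<longleftrightarrow> (\<forall>a b c. separated X d [a, b, c] \<longrightarrow> R (d a b) (d a c))"
  by (auto simp: adjacent_edges_def edge_pairs_related_def numeral_eq_Suc length_Suc_conv)

lemma opposite_edges_iff:
  "opposite_edges R X d \<longleftrightarrow> (\<forall>a b c e. separated X d [a, b, c, e] \<longrightarrow> R (d a b) (d c e))"
  by (auto simp: opposite_edges_def edge_pairs_related_def numeral_eq_Suc length_Suc_conv)

lemma adjacent_edgesD:
  "adjacent_edges R X d \<Longrightarrow> separated X d [a, b, c] \<Longrightarrow> R (d a b) (d a c)"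
  by (simp add: adjacent_edges_iff)

lemma opposite_edgesD:
  "opposite_edges R X d \<Longrightarrow> separated X d [a, b, c, e] \<Longrightarrow> R (d a b) (d c e)"
  by (simp add: opposite_edges_iff)

lemma edge_homogeneous_adjacentD:
  "\<lbrakk>edge_homogeneous X d; separated X d [a, b, c]; separated X d [a', b', c']\<rbrakk>
    \<Longrightarrow> d a b = d a c \<longleftrightarrow> d a' b' = d a' c'"
  unfolding edge_homogeneous_def adjacent_edges_iff by blast

lemma edge_homogeneous_oppositeD:
  "\<lbrakk>edge_homogeneous X d; separated X d [a, b, c, e]; separated X d [a', b', c', e']\<rbrakk>
    \<Longrightarrow> d a b = d c e \<longleftrightarrow> d a' b' = d c' e'"
  unfolding edge_homogeneous_def opposite_edges_iff by blast

lemma separated_mono: "separated Y d xs \<Longrightarrow> Y \<subseteq> X \<Longrightarrow> separated X d xs"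
  by (auto simp: separated_def)

lemma edge_pairs_related_mono:
  "edge_pairs_related R n i j k l X d \<Longrightarrow> Y \<subseteq> X \<Longrightarrow> edge_pairs_related R n i j k l Y d"
  using separated_mono unfolding edge_pairs_related_def by blast

lemma separated_map:
  assumes "\<And>x y. x \<in> X \<Longrightarrow> y \<in> X \<Longrightarrow> \<delta> (\<pi> x) (\<pi> y) = d x y" and "set xs \<subseteq> X"
  shows "separated (\<pi> ` X) \<delta> (map \<pi> xs) \<longleftrightarrow> separated X d xs"
proof -
  have "\<delta> (\<pi> x) (\<pi> y) = d x y" if "x \<in> set xs" "y \<in> set xs" for x y
    using assms that by blast
  then have "sorted_wrt (\<lambda>x y. \<delta> x y \<noteq> 0) (map \<pi> xs) \<longleftrightarrow> sorted_wrt (\<lambda>x y. d x y \<noteq> 0) xs"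
    by (simp add: sorted_wrt_iff_nth_less)
  then show ?thesis
    using assms(2) by (auto simp: separated_def)
qed

lemma edge_pairs_related_image_iff:
  assumes "\<And>x y. x \<in> X \<Longrightarrow> y \<in> X \<Longrightarrow> \<delta> (\<pi> x) (\<pi> y) = d x y"
    and "i < n" "j < n" "k < n" "l < n"
  shows "edge_pairs_related R n i j k l (\<pi> ` X) \<delta> \<longleftrightarrow> edge_pairs_related R n i j k l X d"
proof -
  have "edge_pairs_related R n i j k l (\<pi> ` X) \<delta> \<longleftrightarrow>
      (\<forall>ys\<in>lists (\<pi> ` X). separated (\<pi> ` X) \<delta> ys \<and> length ys = n
        \<longrightarrow> R (\<delta> (ys ! i) (ys ! j)) (\<delta> (ys ! k) (ys ! l)))"
    by (auto simp: edge_pairs_related_def separated_def)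
  also have "\<dots> \<longleftrightarrow> (\<forall>xs\<in>lists X. separated X d xs \<and> length xs = n
      \<longrightarrow> R (d (xs ! i) (xs ! j)) (d (xs ! k) (xs ! l)))"
    unfolding lists_image ball_simps
    using assms by (intro ball_cong refl) (auto simp: separated_map subset_iff)
  also have "\<dots> \<longleftrightarrow> edge_pairs_related R n i j k l X d"
    by (auto simp: edge_pairs_related_def separated_def)
  finally show ?thesis .
qed

lemma edge_homogeneous_image_iff:
  assumes "\<And>x y. x \<in> X \<Longrightarrow> y \<in> X \<Longrightarrow> \<delta> (\<pi> x) (\<pi> y) = d x y"
  shows "edge_homogeneous (\<pi> ` X) \<delta> \<longleftrightarrow> edge_homogeneous X d"
  unfolding edge_homogeneous_def adjacent_edges_def opposite_edges_def
  using edge_pairs_related_image_iff[of X \<delta> \<pi> d, OF assms] by simp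

lemma dist_values_empty [simp]: "dist_values {} d = {}"
  by (simp add: dist_values_def)

lemma dist_values_mono: "Y \<subseteq> X \<Longrightarrow> dist_values Y d \<subseteq> dist_values X d"
  by (auto simp: dist_values_def)

lemma isometric_imp_dist_values_eq:
  assumes "isometric Y Z d"
  shows "dist_values Y d = dist_values Z d"
proof -
  obtain g where g: "g ` Y = Z" "\<forall>x\<in>Y. \<forall>y\<in>Y. d (g x) (g y) = d x y"
    using assms by (auto simp: isometric_def bij_betw_def)
  then have "dist_values Z d = (\<lambda>(x, y). d (g x) (g y)) ` (Y \<times> Y)"
    using dist_values_image[of g Y d] by simp
  also have "\<dots> = case_prod d ` (Y \<times> Y)"
    using g(2) by (intro image_cong) auto
  finally show ?thesis by (simp add: dist_values_conv_image)
qed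

context pseudometric_space
begin

lemma dist_doubleton_cong:
  assumes "{x, y} = {u, v}" "x \<in> X" "y \<in> X"
  shows "d x y = d u v"
  using assms commute[of x y] by (auto simp: doubleton_eq_iff)

lemma dist_cong_zero:
  "\<lbrakk>d x x' = 0; d y y' = 0; x \<in> X; x' \<in> X; y \<in> X; y' \<in> X\<rbrakk> \<Longrightarrow> d x y = d x' y'"
  by (rule dist_cong) (simp_all add: zero_rel_def)

lemma dist_values_insert:
  assumes "x \<in> X" "Y \<subseteq> X"
  shows "dist_values (insert x Y) d = insert 0 (d x ` Y) \<union> dist_values Y d"
proof -
  have "insert x Y \<times> insert x Y = insert (x, x) (Pair x ` Y \<union> (\<lambda>y. (y, x)) ` Y \<union> Y \<times> Y)"
    by auto
  moreover have "(\<lambda>y. d y x) ` Y = d x ` Y"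
    using assms commute by (intro image_cong) auto
  ultimately show ?thesis
    using assms(1) by (simp add: dist_values_conv_image image_Un image_image zero_refl)
qed

lemma dist_values_triple:
  "\<lbrakk>a \<in> X; b \<in> X; c \<in> X\<rbrakk> \<Longrightarrow> dist_values {a, b, c} d = {0, d a b, d a c, d b c}"
  by (auto simp: dist_values_insert)

lemma dist_values_eq_if_zero_dist_to_subset:
  assumes "Y \<subseteq> X" and cover: "\<forall>x\<in>X. \<exists>y\<in>Y. d x y = 0"
  shows "dist_values X d = dist_values Y d"
proof
  show "dist_values Y d \<subseteq> dist_values X d" using assms(1) by (rule dist_values_mono)
  show "dist_values X d \<subseteq> dist_values Y d"
  proof
    fix t assume "t \<in> dist_values X d"
    then obtain x y where xy: "x \<in> X" "y \<in> X" "t = d x y" by (auto simp: dist_values_def)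
    obtain x' y' where x'y': "x' \<in> Y" "y' \<in> Y" "d x x' = 0" "d y y' = 0"
      using cover xy by meson
    then have "t = d x' y'"
      using xy assms(1) by (auto intro!: dist_cong_zero)
    then show "t \<in> dist_values Y d"
      using x'y' unfolding dist_values_def by blast
  qed
qed

lemma metric_subspace_iff:
  "metric_subspace Y X d \<longleftrightarrow> Y \<subseteq> X \<and> (\<forall>x\<in>Y. \<forall>y\<in>Y. d x y = 0 \<longrightarrow> x = y)"
proof (cases "Y \<subseteq> X")
  case True
  then have "pseudometric_space Y d"
    by unfold_locales (auto simp: nonneg zero_refl triangle subset_iff intro: commute)
  then show ?thesis
    using True by (auto simp: metric_subspace_def metric_space_on_def metric_space_on_axioms_def)
qed (simp add: metric_subspace_def)

lemma metric_subspace_insert_iff: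
  "metric_subspace (insert x Y) X d \<longleftrightarrow>
    x \<in> X \<and> metric_subspace Y X d \<and> (\<forall>y\<in>Y. d x y = 0 \<longrightarrow> x = y)"
proof (cases "x \<in> X \<and> Y \<subseteq> X")
  case True
  then have "d y x = d x y" if "y \<in> Y" for y
    using that commute by blast
  then show ?thesis
    using True by (auto simp: metric_subspace_iff)
qed (auto simp: metric_subspace_iff)

lemma separated_iff_metric_subspace:
  "separated X d xs \<longleftrightarrow> distinct xs \<and> metric_subspace (set xs) X d"
proof (induction xs)
  case Nil
  show ?case by (simp add: separated_def metric_subspace_iff)
next
  case (Cons x xs)
  have "separated X d (x # xs) \<longleftrightarrow> x \<in> X \<and> (\<forall>y\<in>set xs. d x y \<noteq> 0) \<and> separated X d xs"
    by (auto simp: separated_def)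
  also have "\<dots> \<longleftrightarrow> distinct (x # xs) \<and> metric_subspace (set (x # xs)) X d"
    using zero_refl[of x] by (auto simp: Cons.IH metric_subspace_insert_iff)
  finally show ?case .
qed

lemma metric_subspace_card_3_iff:
  "metric_subspace Y X d \<and> card Y = 3 \<longleftrightarrow> (\<exists>a b c. Y = {a, b, c} \<and> separated X d [a, b, c])"
  by (auto simp: card_3_iff separated_iff_metric_subspace)

lemma metric_subspace_card_4_iff:
  "metric_subspace Y X d \<and> card Y = 4 \<longleftrightarrow>
    (\<exists>a b c e. Y = {a, b, c, e} \<and> separated X d [a, b, c, e])"
  by (auto simp: card_4_iff separated_iff_metric_subspace)

lemma edge_pairs_related_iff_subspaces:
  "edge_pairs_related R n i j k l X d \<longleftrightarrow>
    (\<forall>Y. metric_subspace Y X d \<and> card Y = n \<longrightarrow> edge_pairs_related R n i j k l Y d)"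
proof (intro iffI allI impI)
  show "edge_pairs_related R n i j k l Y d"
    if "edge_pairs_related R n i j k l X d" "metric_subspace Y X d \<and> card Y = n" for Y
    using that edge_pairs_related_mono by (auto simp: metric_subspace_def)
next
  assume subspaces:
    "\<forall>Y. metric_subspace Y X d \<and> card Y = n \<longrightarrow> edge_pairs_related R n i j k l Y d"
  show "edge_pairs_related R n i j k l X d"
    unfolding edge_pairs_related_def
  proof (intro allI impI)
    fix xs assume xs: "separated X d xs \<and> length xs = n"
    then have "metric_subspace (set xs) X d \<and> card (set xs) = n"
      by (auto simp: separated_iff_metric_subspace distinct_card)
    then have "edge_pairs_related R n i j k l (set xs) d" using subspaces by blast
    moreover have "separated (set xs) d xs" using xs by (simp add: separated_def)
    ultimately show "R (d (xs ! i) (xs ! j)) (d (xs ! k) (xs ! l))"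
      using xs by (simp add: edge_pairs_related_def)
  qed
qed

lemma adjacent_edges_iff_subspaces:
  "adjacent_edges R X d \<longleftrightarrow>
    (\<forall>Y. metric_subspace Y X d \<and> card Y = 3 \<longrightarrow> adjacent_edges R Y d)"
  unfolding adjacent_edges_def by (rule edge_pairs_related_iff_subspaces)

lemma opposite_edges_iff_subspaces:
  "opposite_edges R X d \<longleftrightarrow>
    (\<forall>Y. metric_subspace Y X d \<and> card Y = 4 \<longrightarrow> opposite_edges R Y d)"
  unfolding opposite_edges_def by (rule edge_pairs_related_iff_subspaces)

lemma length_separated_le_card: "separated X d xs \<Longrightarrow> finite X \<Longrightarrow> length xs \<le> card X"
  unfolding separated_iff_metric_subspace metric_subspace_def
  by (metis card_mono distinct_card)

lemma opposite_edges_if_card_less_4: "finite X \<Longrightarrow> card X < 4 \<Longrightarrow> opposite_edges R X d"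
  using length_separated_le_card by (fastforce simp: opposite_edges_iff)

end

context metric_space_on
begin

lemma dist_eq_0_iff: "x \<in> X \<Longrightarrow> y \<in> X \<Longrightarrow> d x y = 0 \<longleftrightarrow> x = y"
  using zero_imp_eq zero_refl by blast

lemma separated_iff_distinct: "separated X d xs \<longleftrightarrow> distinct xs \<and> set xs \<subseteq> X"
  using zero_imp_eq by (auto simp: separated_iff_metric_subspace metric_subspace_iff)

lemma strongly_rigid_metric_iff:
  "strongly_rigid_metric X d \<longleftrightarrow> adjacent_edges (\<noteq>) X d \<and> opposite_edges (\<noteq>) X d"
proof (intro iffI conjI)
  assume "strongly_rigid_metric X d"
  then have rigid: "{x, y} = {u, v}"
    if "d x y = d u v" "x \<noteq> y" "x \<in> X" "y \<in> X" "u \<in> X" "v \<in> X" for x y u v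
    using that zero_imp_eq unfolding strongly_rigid_metric_def by metis
  show "adjacent_edges (\<noteq>) X d"
    using rigid[of a b a c for a b c]
    by (auto simp: adjacent_edges_iff separated_iff_distinct doubleton_eq_iff)
  show "opposite_edges (\<noteq>) X d"
    using rigid[of a b c e for a b c e]
    by (auto simp: opposite_edges_iff separated_iff_distinct doubleton_eq_iff)
next
  assume edges: "adjacent_edges (\<noteq>) X d \<and> opposite_edges (\<noteq>) X d"
  show "strongly_rigid_metric X d"
    unfolding strongly_rigid_metric_def
  proof (intro ballI impI)
    fix x y u v
    assume X: "x \<in> X" "y \<in> X" "u \<in> X" "v \<in> X" and eq: "d x y = d u v \<and> d u v \<noteq> 0"
    then have "x \<noteq> y" "u \<noteq> v" using zero_refl by auto
    then show "{x, y} = {u, v}"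
    proof (cases rule: edge_pair_cases)
      case (adjacent a b c)
      then have "{a, b, c} \<subseteq> X" using X by (auto simp: doubleton_eq_iff)
      then have "d a b \<noteq> d a c"
        using adjacent edges by (auto simp: adjacent_edges_iff separated_iff_distinct)
      then show ?thesis
        using eq dist_doubleton_cong[OF adjacent(1)] dist_doubleton_cong[OF adjacent(2)] X by simp
    next
      case opposite
      then show ?thesis
        using X eq edges by (auto simp: opposite_edges_iff separated_iff_distinct)
    qed
  qed
qed

end

context pseudometric_space
begin

lemma strongly_rigid_iff:
  "strongly_rigid X d \<longleftrightarrow> adjacent_edges (\<noteq>) X d \<and> opposite_edges (\<noteq>) X d"
proof
  assume "strongly_rigid X d"
  then show "adjacent_edges (\<noteq>) X d \<and> opposite_edges (\<noteq>) X d"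
    using metric_space_on.strongly_rigid_metric_iff
    unfolding strongly_rigid_def adjacent_edges_iff_subspaces opposite_edges_iff_subspaces
    by (auto simp: metric_subspace_def)
next
  assume "adjacent_edges (\<noteq>) X d \<and> opposite_edges (\<noteq>) X d"
  then show "strongly_rigid X d"
    using metric_space_on.strongly_rigid_metric_iff edge_pairs_related_mono
    unfolding strongly_rigid_def metric_subspace_def adjacent_edges_def opposite_edges_def by blast
qed

lemma nonzero_dist_eq_if_adjacent_edges_eq:
  assumes adjacent_equal: "adjacent_edges (=) X d"
    and X: "x \<in> X" "y \<in> X" "u \<in> X" "v \<in> X" and nonzero: "d x y \<noteq> 0" "d u v \<noteq> 0"
  shows "d x y = d u v"
proof -
  have common_vertex: "d a b = d a c" if "a \<in> X" "b \<in> X" "c \<in> X" "d a b \<noteq> 0" "d a c \<noteq> 0" for a b c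
  proof (cases "d b c = 0")
    case True
    then show ?thesis using that by (intro dist_cong_zero) (auto simp: zero_refl)
  next
    case False
    then show ?thesis
      using adjacent_edgesD[OF adjacent_equal, of a b c] that by (simp add: separated_def)
  qed
  show ?thesis
  proof (cases "d x u = 0")
    case True
    then have "d x y = d u y" using X by (intro dist_cong_zero) (auto simp: zero_refl)
    also have "\<dots> = d u v" using common_vertex[of u y v] X nonzero calculation by simp
    finally show ?thesis .
  next
    case False
    then have "d x y = d x u" using common_vertex X nonzero by blast
    also have "\<dots> = d u x" using X by (intro commute)
    also have "\<dots> = d u v" using common_vertex[of u x v] X nonzero False commute[of x u] by simp
    finally show ?thesis .
  qed
qed

lemma opposite_edges_eq_if_adjacent_edges_eq:
  "adjacent_edges (=) X d \<Longrightarrow> opposite_edges (=) X d"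
  using nonzero_dist_eq_if_adjacent_edges_eq by (simp add: opposite_edges_iff separated_def)

lemma discrete_pseudometric_iff: "discrete_pseudometric X d \<longleftrightarrow> adjacent_edges (=) X d"
proof
  assume discrete: "discrete_pseudometric X d"
  show "adjacent_edges (=) X d"
    unfolding adjacent_edges_iff
  proof (intro allI impI, rule ccontr)
    fix a b c assume sep: "separated X d [a, b, c]" and "d a b \<noteq> d a c"
    then have "card {0, d a b, d a c} = 3" by (auto simp: separated_def card_insert_if)
    moreover have "{0, d a b, d a c} \<subseteq> dist_values {a, b, c} d"
      using sep by (simp add: dist_values_triple separated_def)
    moreover have "discrete_metric {a, b, c} d"
      using discrete sep by (simp add: discrete_pseudometric_def separated_iff_metric_subspace)
    ultimately show False
      using card_mono[of "dist_values {a, b, c} d" "{0, d a b, d a c}"]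
      by (simp add: discrete_metric_def)
  qed
next
  assume adjacent_equal: "adjacent_edges (=) X d"
  have "\<exists>r. dist_values X d \<subseteq> {0, r}"
  proof (cases "\<exists>x\<in>X. \<exists>y\<in>X. d x y \<noteq> 0")
    case True
    then obtain x y where "x \<in> X" "y \<in> X" "d x y \<noteq> 0" by blast
    then have "dist_values X d \<subseteq> {0, d x y}"
      using nonzero_dist_eq_if_adjacent_edges_eq[OF adjacent_equal] by (auto simp: dist_values_def)
    then show ?thesis ..
  qed (auto simp: dist_values_def)
  then obtain r where two_values: "dist_values X d \<subseteq> {0, r}" ..
  show "discrete_pseudometric X d"
    unfolding discrete_pseudometric_def discrete_metric_def
  proof (intro allI impI)
    fix Y assume "metric_subspace Y X d"
    then have values_Y: "dist_values Y d \<subseteq> {0, r}"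
      using two_values dist_values_mono[of Y X d] by (auto simp: metric_subspace_def)
    have "card (dist_values Y d) \<le> card {0, r}" using values_Y by (intro card_mono) auto
    also have "\<dots> \<le> 2" by (simp add: card_insert_if)
    finally show "finite (dist_values Y d) \<and> card (dist_values Y d) \<le> 2"
      using values_Y finite_subset by auto
  qed
qed

section \<open>Pseudorectangles\<close>

lemma three_point_subspaces_strongly_rigid_iff:
  "(\<forall>Y. metric_subspace Y X d \<and> card Y = 3 \<longrightarrow> strongly_rigid_metric Y d) \<longleftrightarrow>
    adjacent_edges (\<noteq>) X d"
proof -
  have "strongly_rigid_metric Y d \<longleftrightarrow> adjacent_edges (\<noteq>) Y d"
    if "metric_subspace Y X d \<and> card Y = 3" for Y
  proof -
    interpret Y: metric_space_on Y d using that by (simp add: metric_subspace_def)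
    have "finite Y" using that by (simp add: card_ge_0_finite)
    then have "opposite_edges (\<noteq>) Y d" using that by (simp add: Y.opposite_edges_if_card_less_4)
    then show ?thesis by (simp add: Y.strongly_rigid_metric_iff)
  qed
  then show ?thesis by (auto simp: adjacent_edges_iff_subspaces[of "(\<noteq>)"])
qed

lemma side_side_side_isometric:
  assumes "distinct [a, b, c]" "distinct [p, q, r]" "{a, b, c, p, q, r} \<subseteq> X"
    and "d p q = d a b" "d p r = d a c" "d q r = d b c"
  shows "isometric {a, b, c} {p, q, r} d"
proof -
  define g where "g = (\<lambda>x. if x = a then p else if x = b then q else r)"
  have g: "g a = p" "g b = q" "g c = r" using assms(1) by (auto simp: g_def)
  then have "bij_betw g {a, b, c} {p, q, r}"
    using assms by (auto simp: bij_betw_def)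
  moreover have "\<forall>x\<in>{a, b, c}. \<forall>y\<in>{a, b, c}. d (g x) (g y) = d x y"
    using assms zero_refl commute[of q p] commute[of r p] commute[of r q]
      commute[of b a] commute[of c a] commute[of c b] by (simp add: g)
  ultimately show ?thesis unfolding isometric_def by blast
qed

lemma triangle_sides_unequal:
  assumes "adjacent_edges (\<noteq>) X d" "separated X d [a, b, c]"
  shows "d a b \<noteq> d a c" "d a b \<noteq> d b c" "d a c \<noteq> d b c"
proof -
  have "separated X d [b, a, c]" "separated X d [c, a, b]"
    using assms(2) by (auto simp: separated_def commute)
  then show "d a b \<noteq> d a c" "d a b \<noteq> d b c" "d a c \<noteq> d b c"
    using assms adjacent_edgesD[OF assms(1), of a b c] adjacent_edgesD[OF assms(1), of b a c]
      adjacent_edgesD[OF assms(1), of c a b]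
    by (auto simp: separated_def commute)
qed

lemma triangle_relabelling:
  assumes "{\<alpha>, \<beta>, \<gamma>} \<subseteq> {d p q, d p r, d q r}" "distinct [\<alpha>, \<beta>, \<gamma>]"
    and "distinct [p, q, r]" "{p, q, r} \<subseteq> X"
  obtains p' q' r' where "{p', q', r'} = {p, q, r}" "distinct [p', q', r']"
    and "d p' q' = \<alpha>" "d p' r' = \<beta>" "d q' r' = \<gamma>"
proof -
  have comm: "d q p = d p q" "d r p = d p r" "d r q = d q r"
    using assms(4) commute by auto
  consider "d p q = \<alpha>" "d p r = \<beta>" "d q r = \<gamma>" | "d p q = \<alpha>" "d q r = \<beta>" "d p r = \<gamma>"
    | "d p r = \<alpha>" "d p q = \<beta>" "d q r = \<gamma>" | "d p r = \<alpha>" "d q r = \<beta>" "d p q = \<gamma>"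
    | "d q r = \<alpha>" "d p q = \<beta>" "d p r = \<gamma>" | "d q r = \<alpha>" "d p r = \<beta>" "d p q = \<gamma>"
    using assms(1,2) by auto
  then show thesis
  proof cases
    case 1 then show thesis using assms(3) comm by (intro that[of p q r]) auto
  next
    case 2 then show thesis using assms(3) comm by (intro that[of q p r]) auto
  next
    case 3 then show thesis using assms(3) comm by (intro that[of p r q]) auto
  next
    case 4 then show thesis using assms(3) comm by (intro that[of r p q]) auto
  next
    case 5 then show thesis using assms(3) comm by (intro that[of q r p]) auto
  next
    case 6 then show thesis using assms(3) comm by (intro that[of r q p]) auto
  qed
qed

lemma isometric_triples_if_dist_values_eq:
  assumes adjacent_unequal: "adjacent_edges (\<noteq>) X d"
    and abc: "separated X d [a, b, c]" and pqr: "separated X d [p, q, r]"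
    and same_values: "dist_values {a, b, c} d = dist_values {p, q, r} d"
  shows "isometric {a, b, c} {p, q, r} d"
proof -
  have distinct_vertices: "distinct [a, b, c]" "distinct [p, q, r]" and X: "{a, b, c, p, q, r} \<subseteq> X"
    using abc pqr by (auto simp: separated_iff_metric_subspace metric_subspace_def)
  have "{d a b, d a c, d b c} \<subseteq> dist_values {p, q, r} d"
    using X by (simp add: dist_values_triple flip: same_values)
  then have "{d a b, d a c, d b c} \<subseteq> {d p q, d p r, d q r}"
    using X abc by (simp add: dist_values_triple separated_def)
  moreover have "distinct [d a b, d a c, d b c]"
    using triangle_sides_unequal[OF adjacent_unequal abc] by simp
  ultimately obtain p' q' r' where relabelled: "{p', q', r'} = {p, q, r}" "distinct [p', q', r']"
    and "d p' q' = d a b" "d p' r' = d a c" "d q' r' = d b c"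
    using distinct_vertices(2) X by (elim triangle_relabelling) auto
  then have "isometric {a, b, c} {p', q', r'} d"
    using distinct_vertices X by (intro side_side_side_isometric) auto
  then show ?thesis by (simp only: relabelled)
qed

lemma opposite_edges_eq_if_triples_isometric:
  assumes adjacent_unequal: "adjacent_edges (\<noteq>) X d"
    and triples_isometric: "\<forall>Y Z. metric_subspace Y X d \<and> card Y = 3 \<and>
      metric_subspace Z X d \<and> card Z = 3 \<longrightarrow> isometric Y Z d"
  shows "opposite_edges (=) X d"
  unfolding opposite_edges_iff
proof (intro allI impI)
  fix a b c e assume sep: "separated X d [a, b, c, e]"
  then have "separated X d [a, b, c]" "separated X d [a, c, e]"
    and at_c: "separated X d [c, a, e]" "separated X d [c, b, e]"
    by (auto simp: separated_def commute)
  then have "isometric {a, c, e} {a, b, c} d"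
    using triples_isometric metric_subspace_card_3_iff by blast
  then have "dist_values {a, c, e} d = dist_values {a, b, c} d"
    by (rule isometric_imp_dist_values_eq)
  then have "d c e \<in> {0, d a b, d a c, d b c}"
    using sep by (auto simp: dist_values_triple separated_def)
  moreover have "d c e \<noteq> d a c" "d c e \<noteq> d b c"
    using at_c[THEN adjacent_edgesD[OF adjacent_unequal]] sep by (auto simp: separated_def commute)
  ultimately show "d a b = d c e"
    using sep by (auto simp: separated_def)
qed

lemma zero_dist_to_four_points:
  assumes adjacent_unequal: "adjacent_edges (\<noteq>) X d" and opposite_equal: "opposite_edges (=) X d"
    and pqrs: "separated X d [p, q, r, s]" and "x \<in> X"
  shows "\<exists>y\<in>{p, q, r, s}. d x y = 0"
proof (rule ccontr)
  assume "\<not> (\<exists>y\<in>{p, q, r, s}. d x y = 0)"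
  then have pqrx: "separated X d [p, q, r, x]" and rsx: "separated X d [r, s, x]"
    using pqrs \<open>x \<in> X\<close> by (auto simp: separated_def commute)
  have "d r s = d p q" using opposite_edgesD[OF opposite_equal pqrs] by simp
  also have "\<dots> = d r x" using opposite_edgesD[OF opposite_equal pqrx] .
  finally show False using adjacent_edgesD[OF adjacent_unequal rsx] by simp
qed

lemma dist_values_four_points:
  assumes "adjacent_edges (\<noteq>) X d" and opposite_equal: "opposite_edges (=) X d"
    and pqrs: "separated X d [p, q, r, s]"
  shows "dist_values X d = {0, d p q, d p r, d p s}"
proof -
  have "dist_values X d = dist_values {p, q, r, s} d"
    using pqrs zero_dist_to_four_points[OF assms]
    by (intro dist_values_eq_if_zero_dist_to_subset ballI) (auto simp: separated_def)
  also have "\<dots> = {0, d p q, d p r, d p s, d q r, d q s, d r s}"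
    using pqrs by (auto simp: dist_values_insert separated_def)
  also have "\<dots> = {0, d p q, d p r, d p s}"
  proof -
    have "separated X d [p, r, q, s]" "separated X d [p, s, q, r]"
      using pqrs by (auto simp: separated_def commute)
    then have "d r s = d p q" "d q s = d p r" "d q r = d p s"
      using pqrs by (simp_all add: opposite_edgesD[OF opposite_equal])
    then show ?thesis by auto
  qed
  finally show ?thesis .
qed

lemma isometric_triples_if_opposite_edges_eq:
  assumes adjacent_unequal: "adjacent_edges (\<noteq>) X d" and opposite_equal: "opposite_edges (=) X d"
    and pqrs: "separated X d [p, q, r, s]"
    and Y_triple: "metric_subspace Y X d \<and> card Y = 3"
    and Z_triple: "metric_subspace Z X d \<and> card Z = 3"
  shows "isometric Y Z d"
proof -
  have all_values: "dist_values {a, b, c} d = dist_values X d"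
    if abc: "separated X d [a, b, c]" for a b c
  proof (rule card_seteq)
    have "dist_values {a, b, c} d = {0, d a b, d a c, d b c}"
      using abc by (simp add: dist_values_triple separated_def)
    also have "card \<dots> = 4"
      using triangle_sides_unequal[OF adjacent_unequal abc] abc by (simp add: separated_def)
    finally show "card (dist_values X d) \<le> card (dist_values {a, b, c} d)"
      unfolding dist_values_four_points[OF adjacent_unequal opposite_equal pqrs]
      by (simp add: card_insert_if)
    show "finite (dist_values X d)"
      by (simp add: dist_values_four_points[OF adjacent_unequal opposite_equal pqrs])
    show "dist_values {a, b, c} d \<subseteq> dist_values X d"
      using abc by (intro dist_values_mono) (simp add: separated_def)
  qed
  obtain a b c where "Y = {a, b, c}" and abc: "separated X d [a, b, c]"
    using Y_triple unfolding metric_subspace_card_3_iff by blast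
  moreover obtain a' b' c' where "Z = {a', b', c'}" and a'b'c': "separated X d [a', b', c']"
    using Z_triple unfolding metric_subspace_card_3_iff by blast
  ultimately show ?thesis
    using isometric_triples_if_dist_values_eq[OF adjacent_unequal abc a'b'c'] all_values by simp
qed

lemma pseudorectangle_iff:
  "pseudorectangle X d \<longleftrightarrow>
    adjacent_edges (\<noteq>) X d \<and> opposite_edges (=) X d \<and> (\<exists>p q r s. separated X d [p, q, r, s])"
proof (intro iffI conjI)
  assume rect: "pseudorectangle X d"
  then show adjacent_unequal: "adjacent_edges (\<noteq>) X d"
    by (simp add: pseudorectangle_def flip: three_point_subspaces_strongly_rigid_iff)
  show "opposite_edges (=) X d"
    using rect adjacent_unequal unfolding pseudorectangle_def
    by (intro opposite_edges_eq_if_triples_isometric) auto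
  obtain Y where "metric_subspace Y X d \<and> card Y = 4"
    using rect by (auto simp: pseudorectangle_def)
  then show "\<exists>p q r s. separated X d [p, q, r, s]"
    unfolding metric_subspace_card_4_iff by blast
next
  assume edges: "adjacent_edges (\<noteq>) X d \<and> opposite_edges (=) X d \<and>
    (\<exists>p q r s. separated X d [p, q, r, s])"
  then obtain p q r s where pqrs: "separated X d [p, q, r, s]" by blast
  then have "metric_subspace {p, q, r, s} X d \<and> card {p, q, r, s} = 4"
    unfolding metric_subspace_card_4_iff by blast
  then have "\<exists>Y. metric_subspace Y X d \<and> card Y = 4 \<and> (\<forall>x\<in>X. \<exists>y\<in>Y. d x y = 0)"
    using zero_dist_to_four_points[OF _ _ pqrs] edges by blast
  moreover have "\<forall>Y Z. metric_subspace Y X d \<and> card Y = 3 \<and> metric_subspace Z X d \<and> card Z = 3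
      \<longrightarrow> isometric Y Z d"
    using isometric_triples_if_opposite_edges_eq[OF _ _ pqrs] edges by blast
  ultimately show "pseudorectangle X d"
    unfolding pseudorectangle_def three_point_subspaces_strongly_rigid_iff using edges by blast
qed

lemma strongly_rigid_or_discrete_or_pseudorectangle_iff:
  "strongly_rigid X d \<or> discrete_pseudometric X d \<or> pseudorectangle X d \<longleftrightarrow>
    edge_homogeneous X d"
proof -
  have "opposite_edges (\<noteq>) X d" if "\<not> (\<exists>p q r s. separated X d [p, q, r, s])"
    using that by (simp add: opposite_edges_iff)
  then show ?thesis
    unfolding strongly_rigid_iff discrete_pseudometric_iff pseudorectangle_iff
      edge_homogeneous_def
    using opposite_edges_eq_if_adjacent_edges_eq by blast
qed

end

section \<open>Metric spaces in which all permutations are combinatorial self-similarities\<close>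

context metric_space_on
begin

lemma edge_pairs_related_dichotomy_if_Cs_eq_BijGroup:
  assumes Cs: "Cs X d = BijGroup X" and "i < n" "j < n" "k < n" "l < n"
  shows "edge_pairs_related (=) n i j k l X d \<or> edge_pairs_related (\<noteq>) n i j k l X d"
proof (rule disjCI)
  assume "\<not> edge_pairs_related (\<noteq>) n i j k l X d"
  then obtain xs where xs: "separated X d xs" "length xs = n"
    and eq: "d (xs ! i) (xs ! j) = d (xs ! k) (xs ! l)"
    by (auto simp: edge_pairs_related_def)
  show "edge_pairs_related (=) n i j k l X d"
    unfolding edge_pairs_related_def
  proof (intro allI impI)
    fix ys assume "separated X d ys \<and> length ys = n"
    then show "d (ys ! i) (ys ! j) = d (ys ! k) (ys ! l)"
      using Cs_eq_BijGroup_imp_nth_dist_eq_iff[OF Cs, of xs ys i j k l] xs eq assms(2-)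
      by (simp add: separated_iff_distinct)
  qed
qed

lemma edge_homogeneous_imp_image_dist_eq_iff:
  assumes homogeneous: "edge_homogeneous X d" and \<Psi>: "inj_on \<Psi> X" "\<Psi> ` X \<subseteq> X"
    and X: "x \<in> X" "y \<in> X" "u \<in> X" "v \<in> X" and "x \<noteq> y" "u \<noteq> v"
  shows "d (\<Psi> x) (\<Psi> y) = d (\<Psi> u) (\<Psi> v) \<longleftrightarrow> d x y = d u v"
proof -
  have into: "\<Psi> a \<in> X" if "a \<in> X" for a
    using \<Psi>(2) that by blast
  have separated_image: "separated X d (map \<Psi> xs)" if "separated X d xs" for xs
    using \<Psi> that by (auto simp: separated_iff_distinct distinct_map intro: inj_on_subset)
  show ?thesis
    using \<open>x \<noteq> y\<close> \<open>u \<noteq> v\<close>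
  proof (cases rule: edge_pair_cases)
    case same
    then have "{\<Psi> x, \<Psi> y} = {\<Psi> u, \<Psi> v}" by (auto simp: doubleton_eq_iff)
    from dist_doubleton_cong[OF this] dist_doubleton_cong[OF same] show ?thesis
      using X into by simp
  next
    case (adjacent a b c)
    then have abc: "separated X d [a, b, c]"
      using X by (auto simp: separated_iff_distinct doubleton_eq_iff)
    have image: "{\<Psi> x, \<Psi> y} = {\<Psi> a, \<Psi> b}" "{\<Psi> u, \<Psi> v} = {\<Psi> a, \<Psi> c}"
      using adjacent by (auto simp: doubleton_eq_iff)
    have "d (\<Psi> x) (\<Psi> y) = d (\<Psi> a) (\<Psi> b)" "d (\<Psi> u) (\<Psi> v) = d (\<Psi> a) (\<Psi> c)"
      using X into image[THEN dist_doubleton_cong] by simp_all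
    moreover have "d x y = d a b" "d u v = d a c"
      using X adjacent(1,2)[THEN dist_doubleton_cong] by simp_all
    ultimately show ?thesis
      using edge_homogeneous_adjacentD[OF homogeneous _ abc, of "\<Psi> a" "\<Psi> b" "\<Psi> c"]
        separated_image[OF abc] by simp
  next
    case opposite
    then have xyuv: "separated X d [x, y, u, v]"
      using X by (simp add: separated_iff_distinct)
    then show ?thesis
      using separated_image[OF xyuv] by (intro edge_homogeneous_oppositeD[OF homogeneous]) simp_all
  qed
qed

lemma Cs_eq_BijGroup_iff_edge_homogeneous: "Cs X d = BijGroup X \<longleftrightarrow> edge_homogeneous X d"
proof
  assume "Cs X d = BijGroup X"
  then show "edge_homogeneous X d"
    unfolding edge_homogeneous_def adjacent_edges_def opposite_edges_def
    by (intro conjI edge_pairs_related_dichotomy_if_Cs_eq_BijGroup) auto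
next
  assume homogeneous: "edge_homogeneous X d"
  have "preserves_equidistance X d \<Psi>" if \<Psi>: "bij_betw \<Psi> X X" for \<Psi>
    unfolding preserves_equidistance_def
  proof (intro ballI)
    fix x y u v assume X: "x \<in> X" "y \<in> X" "u \<in> X" "v \<in> X"
    have inj: "inj_on \<Psi> X" and image: "\<Psi> ` X \<subseteq> X" using \<Psi> by (auto simp: bij_betw_def)
    have dist_zero_iff: "d (\<Psi> a) (\<Psi> b) = 0 \<longleftrightarrow> a = b" "d a b = 0 \<longleftrightarrow> a = b"
      if "a \<in> X" "b \<in> X" for a b
    proof -
      have "\<Psi> a \<in> X" "\<Psi> b \<in> X" using that image by auto
      then show "d (\<Psi> a) (\<Psi> b) = 0 \<longleftrightarrow> a = b" "d a b = 0 \<longleftrightarrow> a = b"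
        using that by (simp_all add: dist_eq_0_iff inj_on_eq_iff[OF inj])
    qed
    show "d (\<Psi> x) (\<Psi> y) = d (\<Psi> u) (\<Psi> v) \<longleftrightarrow> d x y = d u v"
    proof (cases "x = y \<or> u = v")
      case True
      then show ?thesis
        using dist_zero_iff[OF X(1,2)] dist_zero_iff[OF X(3,4)] by auto
    next
      case False
      then show ?thesis
        using edge_homogeneous_imp_image_dist_eq_iff[OF homogeneous inj image X] by simp
    qed
  qed
  then show "Cs X d = BijGroup X"
    by (simp add: Cs_eq_BijGroup_iff_preserves_equidistance)
qed

end

lemma (in pseudometric_space) edge_homogeneous_reflection_iff:
  "edge_homogeneous (reflection X d) (reflection_dist d) \<longleftrightarrow> edge_homogeneous X d"
proof -
  let ?class = "\<lambda>x. zero_rel X d `` {x}"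
  have reflection: "reflection X d = ?class ` X"
    by (auto simp: reflection_def quotient_def)
  have "reflection_dist d (?class x) (?class y) = d x y" if "x \<in> X" "y \<in> X" for x y
    using that equiv_class_self[OF equiv_zero_rel]
    by (intro reflection_dist_eq) (auto simp: reflection)
  then show ?thesis
    unfolding reflection by (rule edge_homogeneous_image_iff)
qed

theorem theorem4p4:
  fixes X :: "'a set" and d :: "'a \<Rightarrow> 'a \<Rightarrow> real"
  assumes "pseudometric_space X d" and "X \<noteq> {}"
  shows "(strongly_rigid X d \<or> discrete_pseudometric X d \<or> pseudorectangle X d) \<longleftrightarrow>
    Cs (reflection X d) (reflection_dist d) = BijGroup (reflection X d)"
proof -
  interpret pseudometric_space X d by fact
  have "(strongly_rigid X d \<or> discrete_pseudometric X d \<or> pseudorectangle X d) \<longleftrightarrow>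
      edge_homogeneous X d"
    by (rule strongly_rigid_or_discrete_or_pseudorectangle_iff)
  also have "\<dots> \<longleftrightarrow> edge_homogeneous (reflection X d) (reflection_dist d)"
    by (rule edge_homogeneous_reflection_iff[symmetric])
  also have "\<dots> \<longleftrightarrow> Cs (reflection X d) (reflection_dist d) = BijGroup (reflection X d)"
    by (rule metric_space_on.Cs_eq_BijGroup_iff_edge_homogeneous[OF metric_space_reflection,
        symmetric])
  finally show ?thesis .
qed

end
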